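(* Let $m_0>0$ and $g_1>0$. Define $$m_1=\frac{\sqrt[3]{\sqrt6\,m_0^3+9m_0^3}}{3^{2/3}\sqrt[3]{5}}+\frac{\sqrt[3]{5/3}\;m_0^2}{\sqrt[3]{\sqrt6\,m_0^3+9m_0^3}}-2m_0,$$ \begin{align*} m_2=\frac{1}{240m_0^2}\Big(&5\sqrt6\,m_0^3+195m_0^3+8\sqrt[3]{5}\,\big(3(9+\sqrt6)\big)^{2/3}(m_0^3)^{2/3}m_0+\frac{375m_0^6}{\sqrt6\,m_0^3+9m_0^3}\\ &+\frac{120\sqrt[3]{3}\;5^{2/3}m_0^5}{(9+\sqrt6)^{2/3}(m_0^3)^{2/3}}-\frac{120\cdot3^{2/3}\sqrt[3]{\tfrac{5}{9+\sqrt6}}\;m_0^4}{\sqrt[3]{m_0^3}}-24\cdot5^{2/3}\sqrt[3]{3(9+\sqrt6)}\,\sqrt[3]{m_0^3}\,m_0^2\Big). \end{align*} For $x\in[0,1]$ put $m(x)=m_0+m_1x+m_2x^2$, $$EI(x)=\frac{g_1x^4\big(6m_0+x(3m_1+2m_2x)\big)^4}{\big(m_0+x(m_1+m_2x)\big)^3},$$ \begin{align*} T(x)=\frac{g_1x^2\big(6m_0+x(3m_1+2m_2x)\big)^2}{\big(m_0+x(m_1+m_2x)\big)^5}\Big(&-56m_0^4+8m_0^3x(17m_2x-10m_1)+12m_0^2x^2\big(-7m_1^2+8m_1m_2x+2m_2^2x^2\big)\\ &+2m_0x^3\big(-22m_1^3+9m_1^2m_2x+24m_1m_2^2x^2+12m_2^3x^3\big)\\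 &-m_1^2x^4\big(11m_1^2+14m_1m_2x+6m_2^2x^2\big)\Big). \end{align*} Then for all real constants $A_1,A_2$ the function $$u(x,t)=\left(m_0x+\frac{m_1x^2}{2}+\frac{m_2x^3}{3}\right)^2\left(A_1\cos\big(120\sqrt3\sqrt{g_1}\,t\big)+A_2\sin\big(120\sqrt3\sqrt{g_1}\,t\big)\right)$$ satisfies $$\frac{\partial^2}{\partial x^2}\left(EI(x)\frac{\partial^2u}{\partial x^2}\right)+m(x)\frac{\partial^2u}{\partial t^2}-\frac{\partial}{\partial x}\left(T(x)\frac{\partial u}{\partial x}\right)=0$$ for all $x\in[0,1]$ and $t\in\mathbb{R}$, together with the boundary conditions $$u(0,t)=0,\qquad \frac{\partial u}{\partial x}(0,t)=0,\qquad \frac{\partial^2u}{\partial x^2}(1,t)=0,\qquad \frac{\partial^3u}{\partial x^3}(1,t)=0$$ for all $t\in\mathbb{R}$.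
   Context: $EI(x)$ is a single function symbol (bending stiffness), $m(x)$ is the mass per unit length, and $T(x)$ is the axial load of an Euler–Bernoulli beam of unit length, fixed at $x=0$ and free at $x=1$. All cube roots are real cube roots. *)

theory Defs
  imports "HOL-Analysis.Analysis"
begin

text \<open>
  Real cube roots are \<open>root 3\<close>. Every base of an exponent \<open>2/3\<close> is positive when
  \<open>m0 > 0\<close>, so \<open>powr (2/3)\<close> agrees there with the square of the real cube root.
\<close>

definition mass_coeff1 :: "real \<Rightarrow> real" where
  "mass_coeff1 m0 =
     root 3 (sqrt 6 * m0 ^ 3 + 9 * m0 ^ 3) / (3 powr (2/3) * root 3 5)
     + root 3 (5/3) * m0\<^sup>2 / root 3 (sqrt 6 * m0 ^ 3 + 9 * m0 ^ 3)
     - 2 * m0"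

definition mass_coeff2 :: "real \<Rightarrow> real" where
  "mass_coeff2 m0 =
     1 / (240 * m0\<^sup>2) *
     (5 * sqrt 6 * m0 ^ 3 + 195 * m0 ^ 3
      + 8 * root 3 5 * (3 * (9 + sqrt 6)) powr (2/3) * (m0 ^ 3) powr (2/3) * m0
      + 375 * m0 ^ 6 / (sqrt 6 * m0 ^ 3 + 9 * m0 ^ 3)
      + 120 * root 3 3 * 5 powr (2/3) * m0 ^ 5 / ((9 + sqrt 6) powr (2/3) * (m0 ^ 3) powr (2/3))
      - 120 * 3 powr (2/3) * root 3 (5 / (9 + sqrt 6)) * m0 ^ 4 / root 3 (m0 ^ 3)
      - 24 * 5 powr (2/3) * root 3 (3 * (9 + sqrt 6)) * root 3 (m0 ^ 3) * m0\<^sup>2)"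

definition beam_mass :: "real \<Rightarrow> real \<Rightarrow> real \<Rightarrow> real \<Rightarrow> real" where
  "beam_mass m0 m1 m2 x = m0 + m1 * x + m2 * x\<^sup>2"

definition beam_stiffness :: "real \<Rightarrow> real \<Rightarrow> real \<Rightarrow> real \<Rightarrow> real \<Rightarrow> real" where
  "beam_stiffness g1 m0 m1 m2 x =
     g1 * x ^ 4 * (6 * m0 + x * (3 * m1 + 2 * m2 * x)) ^ 4 / (m0 + x * (m1 + m2 * x)) ^ 3"

definition beam_load :: "real \<Rightarrow> real \<Rightarrow> real \<Rightarrow> real \<Rightarrow> real \<Rightarrow> real" where
  "beam_load g1 m0 m1 m2 x =
     g1 * x\<^sup>2 * (6 * m0 + x * (3 * m1 + 2 * m2 * x))\<^sup>2 / (m0 + x * (m1 + m2 * x)) ^ 5 *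
     (- 56 * m0 ^ 4
      + 8 * m0 ^ 3 * x * (17 * m2 * x - 10 * m1)
      + 12 * m0\<^sup>2 * x\<^sup>2 * (- 7 * m1\<^sup>2 + 8 * m1 * m2 * x + 2 * m2\<^sup>2 * x\<^sup>2)
      + 2 * m0 * x ^ 3 *
          (- 22 * m1 ^ 3 + 9 * m1\<^sup>2 * m2 * x + 24 * m1 * m2\<^sup>2 * x\<^sup>2 + 12 * m2 ^ 3 * x ^ 3)
      - m1\<^sup>2 * x ^ 4 * (11 * m1\<^sup>2 + 14 * m1 * m2 * x + 6 * m2\<^sup>2 * x\<^sup>2))"

definition beam_deflection ::
  "real \<Rightarrow> real \<Rightarrow> real \<Rightarrow> real \<Rightarrow> real \<Rightarrow> real \<Rightarrow> real \<Rightarrow> real \<Rightarrow> real" where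
  "beam_deflection g1 m0 m1 m2 A1 A2 x t =
     (m0 * x + m1 * x\<^sup>2 / 2 + m2 * x ^ 3 / 3)\<^sup>2 *
     (A1 * cos (120 * sqrt 3 * sqrt g1 * t) + A2 * sin (120 * sqrt 3 * sqrt g1 * t))"

text \<open>
  Partial derivatives on the strip \<open>{0..1} \<times> UNIV\<close>, as relations so that differentiability is
  part of the claim. The \<open>x\<close>-derivative is one-sided at the ends of the beam. Derivatives
  within \<open>{0..1}\<close> are unique, so the values of \<open>f'\<close> on the strip are determined by \<open>f\<close>.
\<close>

definition has_partial_x :: "(real \<Rightarrow> real \<Rightarrow> real) \<Rightarrow> (real \<Rightarrow> real \<Rightarrow> real) \<Rightarrow> bool" where
  "has_partial_x f f' \<longleftrightarrow>
     (\<forall>x\<in>{0..1}. \<forall>t. ((\<lambda>y. f y t) has_real_derivative f' x t) (at x within {0..1}))"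

definition has_partial_t :: "(real \<Rightarrow> real \<Rightarrow> real) \<Rightarrow> (real \<Rightarrow> real \<Rightarrow> real) \<Rightarrow> bool" where
  "has_partial_t f f' \<longleftrightarrow>
     (\<forall>x\<in>{0..1}. \<forall>t. ((\<lambda>s. f x s) has_real_derivative f' x t) (at t))"

end

theory Submission
  imports Defs
begin

text \<open>
  The mode shape is \<open>W\<^sup>2\<close>, where \<open>W x\<close> is the mass of the segment \<open>{0..x}\<close>, so that \<open>W' = m\<close>.
  Because the stiffness is \<open>1296 g1 W\<^sup>4 / m\<^sup>3\<close>, the bending moment \<open>EI (W\<^sup>2)''\<close> and the shear
  force \<open>V = (EI (W\<^sup>2)'')'\<close> are simple rational expressions in \<open>W\<close>, \<open>m\<close>, \<open>m'\<close>, \<open>m''\<close>. The axial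
  load is exactly the function for which \<open>T (W\<^sup>2)' = V - 14400 g1 W\<^sup>3\<close>
  (\<open>load_times_slope\<close>). Since \<open>(14400 g1 W\<^sup>3)' = 43200 g1 m W\<^sup>2\<close> and
  \<open>43200 g1 = (120 \<surd>3 \<surd>g1)\<^sup>2\<close> is the squared frequency, the equation of motion follows by
  differentiating this identity. This part works for every quadratic mass density without zeros
  in the unit interval, and the conditions at the fixed end hold because \<open>W 0 = 0\<close>.

  The conditions at the free end select the coefficients: they are \<open>m\<^sup>2 + W m' = 0\<close> and
  \<open>3 m m' + W m'' = 0\<close> at \<open>x = 1\<close>. The nested radicals are Cardano's formula in disguise:
  the coefficients are \<open>m1 = (p - 2) m0\<close> and \<open>m2 = 3/2 p (p - 1) m0\<close>, where \<open>p\<close> is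
  the positive root of \<open>p\<^sup>3 = p + 2/5\<close> (\<open>mass_coeffs_via_cubic\<close>). With this
  parametrization both conditions are multiples of the cubic equation, and \<open>p > 23/20\<close>
  makes the discriminant of the mass density negative, which excludes zeros of the mass.
\<close>

section \<open>The mode shape for an arbitrary quadratic mass density\<close>

definition mass_upto :: "real \<Rightarrow> real \<Rightarrow> real \<Rightarrow> real \<Rightarrow> real" where
  "mass_upto m0 m1 m2 x = m0 * x + m1 * x\<^sup>2 / 2 + m2 * x ^ 3 / 3"

definition mass_slope :: "real \<Rightarrow> real \<Rightarrow> real \<Rightarrow> real" where
  "mass_slope m1 m2 x = m1 + 2 * m2 * x"

lemma has_derivative_mass_upto [derivative_intros]:
  "(mass_upto m0 m1 m2 has_real_derivative beam_mass m0 m1 m2 x) (at x)"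
  unfolding mass_upto_def beam_mass_def
  by (auto intro!: derivative_eq_intros simp: power2_eq_square)

lemma has_derivative_beam_mass [derivative_intros]:
  "(beam_mass m0 m1 m2 has_real_derivative mass_slope m1 m2 x) (at x)"
  unfolding beam_mass_def mass_slope_def
  by (auto intro!: derivative_eq_intros)

lemma has_derivative_mass_slope [derivative_intros]:
  "(mass_slope m1 m2 has_real_derivative 2 * m2) (at x)"
  unfolding mass_slope_def
  by (auto intro!: derivative_eq_intros)

lemma mass_upto_factor:
  "x * (6 * m0 + x * (3 * m1 + 2 * m2 * x)) = 6 * mass_upto m0 m1 m2 x"
  by (simp add: mass_upto_def power2_eq_square power3_eq_cube algebra_simps)

lemma beam_mass_horner: "m0 + x * (m1 + m2 * x) = beam_mass m0 m1 m2 x"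
  by (simp add: beam_mass_def power2_eq_square algebra_simps)

lemma beam_stiffness_eq:
  "beam_stiffness g m0 m1 m2 x = 1296 * g * mass_upto m0 m1 m2 x ^ 4 / beam_mass m0 m1 m2 x ^ 3"
proof -
  have "x ^ 4 * (6 * m0 + x * (3 * m1 + 2 * m2 * x)) ^ 4 = (6 * mass_upto m0 m1 m2 x) ^ 4"
    by (simp only: mass_upto_factor [symmetric] power_mult_distrib)
  then show ?thesis
    by (simp add: beam_stiffness_def beam_mass_horner mult.assoc)
qed

definition bending_moment :: "real \<Rightarrow> real \<Rightarrow> real \<Rightarrow> real \<Rightarrow> real \<Rightarrow> real" where
  "bending_moment g m0 m1 m2 x =
     beam_stiffness g m0 m1 m2 x *
     (2 * ((beam_mass m0 m1 m2 x)\<^sup>2 + mass_upto m0 m1 m2 x * mass_slope m1 m2 x))"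

definition shear_force :: "real \<Rightarrow> real \<Rightarrow> real \<Rightarrow> real \<Rightarrow> real \<Rightarrow> real" where
  "shear_force g m0 m1 m2 x =
     (let w = mass_upto m0 m1 m2 x; \<mu> = beam_mass m0 m1 m2 x; d = mass_slope m1 m2 x
      in 2592 * g * (4 * w ^ 3 + 4 * w ^ 4 * d / \<mu>\<^sup>2 + 2 * m2 * w ^ 5 / \<mu> ^ 3 - 3 * w ^ 5 * d\<^sup>2 / \<mu> ^ 4))"

text \<open>
  The long polynomial in \<open>beam_load\<close> is a combination of monomials in \<open>W\<close> and the derivatives of
  the mass; the bracket multiplied by 36 comes from the shear force, and the term with 200 from
  the inertia of the beam.
\<close>

lemma load_polynomial_eq:
  fixes m0 m1 m2 x :: real
  defines "w \<equiv> mass_upto m0 m1 m2 x" and "\<mu> \<equiv> beam_mass m0 m1 m2 x" and "d \<equiv> mass_slope m1 m2 x"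
  shows "- 56 * m0 ^ 4
      + 8 * m0 ^ 3 * x * (17 * m2 * x - 10 * m1)
      + 12 * m0\<^sup>2 * x\<^sup>2 * (- 7 * m1\<^sup>2 + 8 * m1 * m2 * x + 2 * m2\<^sup>2 * x\<^sup>2)
      + 2 * m0 * x ^ 3 *
          (- 22 * m1 ^ 3 + 9 * m1\<^sup>2 * m2 * x + 24 * m1 * m2\<^sup>2 * x\<^sup>2 + 12 * m2 ^ 3 * x ^ 3)
      - m1\<^sup>2 * x ^ 4 * (11 * m1\<^sup>2 + 14 * m1 * m2 * x + 6 * m2\<^sup>2 * x\<^sup>2)
    = 36 * (4 * \<mu> ^ 4 + 4 * w * d * \<mu>\<^sup>2 + 2 * m2 * w\<^sup>2 * \<mu> - 3 * w\<^sup>2 * d\<^sup>2) - 200 * \<mu> ^ 4"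
proof -
  have "6 * w = 6 * m0 * x + 3 * m1 * x\<^sup>2 + 2 * m2 * x ^ 3"
    by (simp add: w_def mass_upto_def)
  then show ?thesis
    unfolding \<mu>_def d_def beam_mass_def mass_slope_def by algebra
qed

text \<open>
  The equation of motion, integrated once over \<open>{0..x}\<close>; the constant of integration vanishes
  because there is neither shear nor mass to the left of \<open>x = 0\<close>.
\<close>

lemma load_times_slope:
  assumes "beam_mass m0 m1 m2 x \<noteq> 0"
  shows "beam_load g m0 m1 m2 x * (2 * mass_upto m0 m1 m2 x * beam_mass m0 m1 m2 x)
    = shear_force g m0 m1 m2 x - 14400 * g * mass_upto m0 m1 m2 x ^ 3"
proof -
  define w where "w = mass_upto m0 m1 m2 x"
  define \<mu> where "\<mu> = beam_mass m0 m1 m2 x"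
  define d where "d = mass_slope m1 m2 x"
  have factor: "x\<^sup>2 * (6 * m0 + x * (3 * m1 + 2 * m2 * x))\<^sup>2 = 36 * w\<^sup>2"
    unfolding w_def by (simp add: power_mult_distrib [symmetric] mass_upto_factor)
  have load: "beam_load g m0 m1 m2 x = g * (36 * w\<^sup>2) / \<mu> ^ 5 *
      (36 * (4 * \<mu> ^ 4 + 4 * w * d * \<mu>\<^sup>2 + 2 * m2 * w\<^sup>2 * \<mu> - 3 * w\<^sup>2 * d\<^sup>2) - 200 * \<mu> ^ 4)"
    unfolding beam_load_def load_polynomial_eq mult.assoc [of g "x\<^sup>2"] factor
    by (simp only: beam_mass_horner w_def \<mu>_def d_def)
  have "\<mu> \<noteq> 0"
    using assms by (simp add: \<mu>_def)
  then show ?thesis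
    unfolding load shear_force_def Let_def
    unfolding w_def [symmetric] \<mu>_def [symmetric] d_def [symmetric]
    by (simp add: divide_simps) algebra
qed

lemma has_derivative_bending_moment:
  assumes "beam_mass m0 m1 m2 x \<noteq> 0"
  shows "(bending_moment g m0 m1 m2 has_real_derivative shear_force g m0 m1 m2 x) (at x)"
proof -
  define w where "w = mass_upto m0 m1 m2"
  define \<mu> where "\<mu> = beam_mass m0 m1 m2"
  define d where "d = mass_slope m1 m2"
  have derivs: "(w has_real_derivative \<mu> x) (at x)" "(\<mu> has_real_derivative d x) (at x)"
    "(d has_real_derivative 2 * m2) (at x)"
    unfolding w_def \<mu>_def d_def by (rule derivative_intros)+
  have nz: "\<mu> x \<noteq> 0"
    using assms by (simp add: \<mu>_def)
  show ?thesis
    unfolding bending_moment_def beam_stiffness_eq shear_force_def Let_def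
    unfolding w_def [symmetric] \<mu>_def [symmetric] d_def [symmetric]
    by ((rule derivative_eq_intros derivs refl nz power_not_zero)+,
        use nz in \<open>simp add: divide_simps\<close>, algebra)
qed

text \<open>
  The derivative of the shear force is left unevaluated: it occurs in both the bending term and
  the load term of the equation of motion and cancels.
\<close>

lemma shear_force_differentiable:
  assumes "beam_mass m0 m1 m2 x \<noteq> 0"
  shows "(shear_force g m0 m1 m2 has_real_derivative deriv (shear_force g m0 m1 m2) x) (at x)"
proof -
  have "mass_upto m0 m1 m2 differentiable at x" "beam_mass m0 m1 m2 differentiable at x"
    "mass_slope m1 m2 differentiable at x"
    unfolding real_differentiable_def by (blast intro: derivative_intros)+
  then have "shear_force g m0 m1 m2 differentiable at x"
    unfolding shear_force_def Let_def
    using assms by (intro derivative_intros) auto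
  then show ?thesis
    by (simp add: DERIV_deriv_iff_real_differentiable)
qed

section \<open>Cardano's formula behind the mass coefficients\<close>

lemma powr_two_thirds:
  fixes x :: real
  assumes "x > 0"
  shows "x powr (2/3) = (root 3 x)\<^sup>2"
proof -
  have "root 3 x = x powr (1/3)"
    using assms by (simp add: root_powr_inverse)
  then show ?thesis
    using assms by (simp add: powr_powr flip: powr_numeral)
qed

text \<open>
  With \<open>\<kappa> = root 3 (9 + \<surd>6)\<close>, the two quotients in \<open>mass_coeff1\<close> are \<open>m0 y\<close> and \<open>m0 z\<close>, where
  \<open>y\<^sup>3 = (9 + \<surd>6)/45\<close> and \<open>z\<^sup>3 = (9 - \<surd>6)/45\<close>. As \<open>3 y z = 1\<close>, the sum \<open>p = y + z\<close> satisfies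
  \<open>p\<^sup>3 = y\<^sup>3 + z\<^sup>3 + p\<close>. The radicals in \<open>mass_coeff2\<close> are multiples of \<open>y\<close>, \<open>z\<close>, \<open>y\<^sup>2\<close>, \<open>z\<^sup>2\<close>.
\<close>

lemma mass_coeffs_via_cubic:
  assumes "m0 > 0"
  obtains p where "p > 0" "p ^ 3 = p + 2/5"
    "mass_coeff1 m0 = (p - 2) * m0" "mass_coeff2 m0 = 3/2 * p * (p - 1) * m0"
proof -
  define s where "s = root 3 3"
  define r where "r = root 3 5"
  define \<kappa> where "\<kappa> = root 3 (9 + sqrt 6)"
  define y where "y = \<kappa> / (s\<^sup>2 * r)"
  define z where "z = r / (s * \<kappa>)"
  have pos: "s > 0" "r > 0" "\<kappa> > 0" and nine: "9 + sqrt 6 > 0"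
    by (auto simp: s_def r_def \<kappa>_def intro!: add_pos_nonneg)
  have cubes: "s ^ 3 = 3" "r ^ 3 = 5" "\<kappa> ^ 3 = 9 + sqrt 6"
    using nine by (simp_all add: s_def r_def \<kappa>_def)
  have conj: "(9 + sqrt 6) * (9 - sqrt 6) = 75"
    by (simp add: algebra_simps)
  have yz: "3 * y * z = 1"
    using pos cubes by (simp add: y_def z_def field_simps power3_eq_cube power2_eq_square)
  have y3: "y ^ 3 = (9 + sqrt 6) / 45"
  proof -
    have "y ^ 3 = \<kappa> ^ 3 / ((s ^ 3)\<^sup>2 * r ^ 3)"
      by (simp add: y_def power_divide power_mult_distrib flip: power_mult)
    then show ?thesis by (simp add: cubes)
  qed
  have recip: "1 / (9 + sqrt 6) = (9 - sqrt 6) / 75"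
    using conj nine by (simp add: field_simps)
  have z3: "z ^ 3 = (9 - sqrt 6) / 45"
  proof -
    have "z ^ 3 = r ^ 3 / (s ^ 3 * \<kappa> ^ 3)"
      by (simp add: z_def power_divide power_mult_distrib)
    also have "\<dots> = 5/3 * (1 / (9 + sqrt 6))"
      by (simp add: cubes)
    finally show ?thesis by (simp add: recip)
  qed
  have yzpos: "y > 0" "z > 0"
    using pos by (simp_all add: y_def z_def)
  have cubic: "(y + z) ^ 3 = (y + z) + 2/5"
  proof -
    have "(y + z) ^ 3 = y ^ 3 + z ^ 3 + (3 * y * z) * (y + z)"
      by (simp add: algebra_simps power3_eq_cube)
    also have "\<dots> = (9 + sqrt 6) / 45 + (9 - sqrt 6) / 45 + (y + z)"
      by (simp only: yz y3 z3 mult_1)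
    also have "\<dots> = (y + z) + 2/5"
      by (simp add: diff_divide_distrib add_divide_distrib)
    finally show ?thesis .
  qed
  have sum_eq: "sqrt 6 * m0 ^ 3 + 9 * m0 ^ 3 = (9 + sqrt 6) * m0 ^ 3"
    by (simp add: algebra_simps)
  have rm: "root 3 (m0 ^ 3) = m0"
    using assms by (simp add: real_root_power_cancel)
  have coeff1: "mass_coeff1 m0 = (y + z - 2) * m0"
  proof -
    have "mass_coeff1 m0 = \<kappa> * m0 / (s\<^sup>2 * r) + r / s * m0\<^sup>2 / (\<kappa> * m0) - 2 * m0"
      unfolding mass_coeff1_def sum_eq
      by (simp add: real_root_mult real_root_divide rm powr_two_thirds s_def r_def \<kappa>_def)
    also have "\<dots> = (y + z - 2) * m0"
      using assms by (simp add: y_def z_def algebra_simps power2_eq_square)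
    finally show ?thesis .
  qed
  have coeff2: "mass_coeff2 m0 = 3/2 * (y + z) * (y + z - 1) * m0"
  proof -
    have k: "\<kappa> = s\<^sup>2 * r * y"
      using pos by (simp add: y_def)
    have t1: "8 * r * (s * \<kappa>)\<^sup>2 = 360 * y\<^sup>2"
    proof -
      have "8 * r * (s * \<kappa>)\<^sup>2 = 8 * (s ^ 3)\<^sup>2 * r ^ 3 * y\<^sup>2"
        unfolding k by (simp add: eval_nat_numeral)
      then show ?thesis by (simp add: cubes)
    qed
    have t2: "120 * s * r\<^sup>2 / \<kappa>\<^sup>2 = 360 * z\<^sup>2"
    proof -
      have "z\<^sup>2 = s * r\<^sup>2 / (s ^ 3 * \<kappa>\<^sup>2)"
        using pos by (simp add: z_def eval_nat_numeral)
      then show ?thesis by (simp add: cubes)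
    qed
    have t3: "120 * s\<^sup>2 * (r / \<kappa>) = 360 * z"
    proof -
      have "z = s\<^sup>2 * r / (s ^ 3 * \<kappa>)"
        using pos by (simp add: z_def eval_nat_numeral)
      then show ?thesis by (simp add: cubes)
    qed
    have t4: "24 * r\<^sup>2 * (s * \<kappa>) = 360 * y"
    proof -
      have "24 * r\<^sup>2 * (s * \<kappa>) = 24 * s ^ 3 * r ^ 3 * y"
        unfolding k by (simp add: eval_nat_numeral)
      then show ?thesis by (simp add: cubes)
    qed
    have t5: "375 * m0 ^ 6 / ((9 + sqrt 6) * m0 ^ 3) = 5 * (9 - sqrt 6) * m0 ^ 3"
    proof -
      have "375 * m0 ^ 6 / ((9 + sqrt 6) * m0 ^ 3) = 375 * m0 ^ 3 * (1 / (9 + sqrt 6))"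
        using assms by (simp add: eval_nat_numeral)
      then show ?thesis by (simp add: recip)
    qed
    have "mass_coeff2 m0 = 1 / (240 * m0\<^sup>2) *
        (5 * sqrt 6 * m0 ^ 3 + 195 * m0 ^ 3
         + 8 * r * (s * \<kappa>)\<^sup>2 * m0\<^sup>2 * m0
         + 375 * m0 ^ 6 / ((9 + sqrt 6) * m0 ^ 3)
         + 120 * s * r\<^sup>2 * m0 ^ 5 / (\<kappa>\<^sup>2 * m0\<^sup>2)
         - 120 * s\<^sup>2 * (r / \<kappa>) * m0 ^ 4 / m0
         - 24 * r\<^sup>2 * (s * \<kappa>) * m0 * m0\<^sup>2)"
    proof -
      have "(3 * (9 + sqrt 6)) powr (2/3) = (s * \<kappa>)\<^sup>2" "(m0 ^ 3) powr (2/3) = m0\<^sup>2"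
        "5 powr (2/3) = r\<^sup>2" "3 powr (2/3) = s\<^sup>2" "(9 + sqrt 6) powr (2/3) = \<kappa>\<^sup>2"
        "root 3 (3 * (9 + sqrt 6)) = s * \<kappa>" "root 3 (5 / (9 + sqrt 6)) = r / \<kappa>"
        using assms nine
        by (simp_all add: powr_two_thirds real_root_mult real_root_divide rm s_def r_def \<kappa>_def
            del: distrib_left_numeral)
      then show ?thesis
        unfolding mass_coeff2_def sum_eq by (simp only: rm r_def [symmetric] s_def [symmetric])
    qed
    also have "\<dots> = 1 / (240 * m0\<^sup>2) *
        (5 * sqrt 6 * m0 ^ 3 + 195 * m0 ^ 3 + 360 * y\<^sup>2 * m0\<^sup>2 * m0
         + 5 * (9 - sqrt 6) * m0 ^ 3 + 120 * s * r\<^sup>2 / \<kappa>\<^sup>2 * m0 ^ 3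
         - 120 * s\<^sup>2 * (r / \<kappa>) * m0 ^ 3 - 360 * y * m0 * m0\<^sup>2)"
      unfolding t1 t4 t5 using assms by (simp add: eval_nat_numeral)
    also have "\<dots> = (240 + 360 * (y\<^sup>2 + z\<^sup>2) - 360 * (y + z)) / 240 * m0"
      unfolding t2 t3 using assms by (simp add: field_simps eval_nat_numeral)
    also have "\<dots> = (240 + 360 * ((y + z)\<^sup>2 - 2 * (y * z)) - 360 * (y + z)) / 240 * m0"
      by (simp add: power2_eq_square algebra_simps)
    also have "\<dots> = 3/2 * (y + z) * (y + z - 1) * m0"
    proof -
      have "y * z = 1/3" using yz by simp
      then show ?thesis by (simp add: power2_eq_square field_simps)
    qed
    finally show ?thesis .
  qed
  show thesis
    using that [of "y + z"] yzpos cubic coeff1 coeff2 by simp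
qed

text \<open>
  The mass density has discriminant \<open>(4 + 2 p - 5 p\<^sup>2) m0\<^sup>2\<close>, negative for \<open>p > (1 + \<surd>21)/5\<close>, that
  is beyond about 1.117, while the cubic has its root near 1.160; the bound 23/20 separates them.
\<close>

lemma cubic_root_lower_bound:
  fixes p :: real
  assumes "p > 0" "p ^ 3 = p + 2/5"
  shows "p > 23/20"
proof (rule ccontr)
  assume "\<not> p > 23/20"
  then have le: "p \<le> 23/20" by simp
  have "p * p \<le> 23/20 * (23/20)"
    by (rule mult_mono) (use le assms in auto)
  then have "p * (p * p - 1) \<le> p * (23/20 * (23/20) - 1)"
    using assms by (intro mult_left_mono) auto
  also have "\<dots> \<le> 23/20 * (23/20 * (23/20) - 1)"
    using le by (intro mult_right_mono) auto
  finally show False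
    using assms(2) by (simp add: power3_eq_cube algebra_simps)
qed

lemma beam_mass_pos:
  assumes "m0 > 0" "p > 0" "p ^ 3 = p + 2/5"
  shows "beam_mass m0 ((p - 2) * m0) (3/2 * p * (p - 1) * m0) x > 0"
proof -
  have p: "p > 23/20"
    using cubic_root_lower_bound assms by blast
  define c where "c = 3/2 * p * (p - 1)"
  have c: "c > 0"
    using p by (simp add: c_def)
  have disc: "4 * c - (p - 2)\<^sup>2 > 0"
  proof -
    \<comment> \<open>Expansion around the lower bound for \<open>p\<close>, so that every term is nonnegative.\<close>
    have "4 * c - (p - 2)\<^sup>2 = 5 * (p - 23/20)\<^sup>2 + 19/2 * (p - 23/20) + 5/16"
      by (simp add: c_def power2_eq_square field_simps)
    also have "\<dots> > 0"
      using p by (intro add_nonneg_pos add_nonneg_nonneg) auto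
    finally show ?thesis .
  qed
  have "4 * c * (1 + (p - 2) * x + c * x\<^sup>2) = (2 * c * x + (p - 2))\<^sup>2 + (4 * c - (p - 2)\<^sup>2)"
    by (simp add: power2_eq_square algebra_simps)
  also have "\<dots> > 0"
    using disc by (intro add_nonneg_pos) auto
  finally have "1 + (p - 2) * x + c * x\<^sup>2 > 0"
    using c by (simp add: zero_less_mult_iff)
  moreover have "beam_mass m0 ((p - 2) * m0) (3/2 * p * (p - 1) * m0) x
      = m0 * (1 + (p - 2) * x + c * x\<^sup>2)"
    by (simp add: beam_mass_def c_def algebra_simps)
  ultimately show ?thesis
    using assms by simp
qed

text \<open>
  For the cubic parametrization, \<open>W 1 = p\<^sup>2 m0 / 2\<close>; the two combinations below are half the
  second and half the third derivative of \<open>W\<^sup>2\<close> at the free end, and each is a polynomial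
  multiple of \<open>p\<^sup>3 - p - 2/5\<close>.
\<close>

lemma free_end_conditions:
  fixes m0 p :: real
  assumes "p ^ 3 = p + 2/5"
  defines "m1 \<equiv> (p - 2) * m0" and "m2 \<equiv> 3/2 * p * (p - 1) * m0"
  shows "(beam_mass m0 m1 m2 1)\<^sup>2 + mass_upto m0 m1 m2 1 * mass_slope m1 m2 1 = 0"
    and "3 * beam_mass m0 m1 m2 1 * mass_slope m1 m2 1 + 2 * m2 * mass_upto m0 m1 m2 1 = 0"
proof -
  have M: "beam_mass m0 m1 m2 1 = (p - 1) * (3 * p + 2) / 2 * m0"
    and W: "mass_upto m0 m1 m2 1 = p\<^sup>2 / 2 * m0"
    and D: "mass_slope m1 m2 1 = (3 * p\<^sup>2 - 2 * p - 2) * m0"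
    by (simp_all add: beam_mass_def mass_upto_def mass_slope_def m1_def m2_def field_simps
        power2_eq_square)
  have q: "p ^ 3 - p - 2/5 = 0"
    using assms(1) by simp
  have "(beam_mass m0 m1 m2 1)\<^sup>2 + mass_upto m0 m1 m2 1 * mass_slope m1 m2 1
      = 5/4 * (3 * p - 2) * m0\<^sup>2 * (p ^ 3 - p - 2/5)"
    unfolding M W D by (simp add: field_simps eval_nat_numeral)
  then show "(beam_mass m0 m1 m2 1)\<^sup>2 + mass_upto m0 m1 m2 1 * mass_slope m1 m2 1 = 0"
    by (simp add: q)
  have "3 * beam_mass m0 m1 m2 1 * mass_slope m1 m2 1 + 2 * m2 * mass_upto m0 m1 m2 1
      = 15 * (p - 1) * m0\<^sup>2 * (p ^ 3 - p - 2/5)"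
    unfolding M W D by (simp add: m2_def field_simps eval_nat_numeral)
  then show "3 * beam_mass m0 m1 m2 1 * mass_slope m1 m2 1 + 2 * m2 * mass_upto m0 m1 m2 1 = 0"
    by (simp add: q)
qed

section \<open>Separation of variables\<close>

lemma has_partial_x_separated:
  assumes "\<And>x t. x \<in> {0..1} \<Longrightarrow> f x t = X x * \<tau> t"
    and "\<And>x. x \<in> {0..1} \<Longrightarrow> (X has_real_derivative X' x) (at x)"
  shows "has_partial_x f (\<lambda>x t. X' x * \<tau> t)"
  unfolding has_partial_x_def
proof (intro ballI allI)
  fix x t :: real
  assume x: "x \<in> {0..1}"
  have "((\<lambda>y. X y * \<tau> t) has_real_derivative X' x * \<tau> t) (at x within {0..1})"
    by (rule DERIV_cmult_right [OF has_field_derivative_at_within [OF assms(2) [OF x]]])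
  then show "((\<lambda>y. f y t) has_real_derivative X' x * \<tau> t) (at x within {0..1})"
    by (rule has_field_derivative_transform_within [OF _ zero_less_one x]) (simp add: assms(1))
qed

lemma has_partial_t_separated:
  assumes "\<And>x t. x \<in> {0..1} \<Longrightarrow> f x t = X x * \<tau> t"
    and "\<And>t. (\<tau> has_real_derivative \<tau>' t) (at t)"
  shows "has_partial_t f (\<lambda>x t. X x * \<tau>' t)"
  unfolding has_partial_t_def
proof (intro ballI allI)
  fix x t :: real
  assume "x \<in> {0..1}"
  then have "(\<lambda>s. f x s) = (\<lambda>s. X x * \<tau> s)"
    by (simp add: assms(1) fun_eq_iff)
  then show "((\<lambda>s. f x s) has_real_derivative X x * \<tau>' t) (at t)"
    using DERIV_cmult [OF assms(2)] by simp
qed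

theorem mainTheorem4:
  fixes m0 m1 m2 g1 A1 A2 :: real
    and m EI T :: "real \<Rightarrow> real"
    and u :: "real \<Rightarrow> real \<Rightarrow> real"
  assumes "m0 > 0" and "g1 > 0"
    and "m1 = mass_coeff1 m0"
    and "m2 = mass_coeff2 m0"
    and "\<forall>x\<in>{0..1}. m x = beam_mass m0 m1 m2 x"
    and "\<forall>x\<in>{0..1}. EI x = beam_stiffness g1 m0 m1 m2 x"
    and "\<forall>x\<in>{0..1}. T x = beam_load g1 m0 m1 m2 x"
    and "\<forall>x\<in>{0..1}. \<forall>t. u x t = beam_deflection g1 m0 m1 m2 A1 A2 x t"
  shows "\<exists>u_x u_xx u_xxx u_t u_tt M_x M_xx N_x.
           has_partial_x u u_x \<and> has_partial_x u_x u_xx \<and> has_partial_x u_xx u_xxx \<and>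
           has_partial_t u u_t \<and> has_partial_t u_t u_tt \<and>
           has_partial_x (\<lambda>x t. EI x * u_xx x t) M_x \<and> has_partial_x M_x M_xx \<and>
           has_partial_x (\<lambda>x t. T x * u_x x t) N_x \<and>
           (\<forall>x\<in>{0..1}. \<forall>t. M_xx x t + m x * u_tt x t - N_x x t = 0) \<and>
           (\<forall>t. u 0 t = 0 \<and> u_x 0 t = 0 \<and> u_xx 1 t = 0 \<and> u_xxx 1 t = 0)"
proof -
  obtain p where p: "p > 0" "p ^ 3 = p + 2/5"
    and coeffs: "m1 = (p - 2) * m0" "m2 = 3/2 * p * (p - 1) * m0"
    using mass_coeffs_via_cubic [OF assms(1)] assms(3,4) by metis
  define w where "w = mass_upto m0 m1 m2"
  define \<mu> where "\<mu> = beam_mass m0 m1 m2"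
  define d where "d = mass_slope m1 m2"
  define V where "V = shear_force g1 m0 m1 m2"
  define \<omega> where "\<omega> = 120 * sqrt 3 * sqrt g1"
  define \<tau> where "\<tau> t = A1 * cos (\<omega> * t) + A2 * sin (\<omega> * t)" for t
  define \<tau>' where "\<tau>' t = \<omega> * (A2 * cos (\<omega> * t) - A1 * sin (\<omega> * t))" for t
  have \<mu>: "\<mu> x \<noteq> 0" for x
    using beam_mass_pos [OF assms(1) p] by (simp add: \<mu>_def coeffs less_imp_neq [symmetric])
  have freq: "\<omega>\<^sup>2 = 43200 * g1"
    using assms(2) by (simp add: \<omega>_def power_mult_distrib)
  have u: "u x t = (w x)\<^sup>2 * \<tau> t" if "x \<in> {0..1}" for x t
    using assms(8) that by (simp add: beam_deflection_def w_def mass_upto_def \<tau>_def \<omega>_def)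
  have dw: "(w has_real_derivative \<mu> x) (at x)" for x
    unfolding w_def \<mu>_def by (rule derivative_intros)
  have d\<mu>: "(\<mu> has_real_derivative d x) (at x)" for x
    unfolding d_def \<mu>_def by (rule derivative_intros)
  have dd: "(d has_real_derivative 2 * m2) (at x)" for x
    unfolding d_def by (rule derivative_intros)
  have dV: "(V has_real_derivative deriv V x) (at x)" for x
    unfolding V_def using \<mu> by (intro shear_force_differentiable) (simp add: \<mu>_def)
  note derivs = dw d\<mu> dd dV
  have tau: "(\<tau> has_real_derivative \<tau>' t) (at t)" for t
    unfolding \<tau>_def \<tau>'_def by (auto intro!: derivative_eq_intros simp: algebra_simps)
  have tau': "(\<tau>' has_real_derivative - \<omega>\<^sup>2 * \<tau> t) (at t)" for t
    unfolding \<tau>_def \<tau>'_def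
    by (auto intro!: derivative_eq_intros simp: algebra_simps power2_eq_square)

  define u_x where "u_x x t = 2 * w x * \<mu> x * \<tau> t" for x t
  define u_xx where "u_xx x t = 2 * ((\<mu> x)\<^sup>2 + w x * d x) * \<tau> t" for x t
  define u_xxx where "u_xxx x t = 2 * (3 * \<mu> x * d x + 2 * m2 * w x) * \<tau> t" for x t
  define u_t where "u_t x t = (w x)\<^sup>2 * \<tau>' t" for x t
  define u_tt where "u_tt x t = (w x)\<^sup>2 * (- \<omega>\<^sup>2 * \<tau> t)" for x t
  define M_x where "M_x x t = V x * \<tau> t" for x t
  define M_xx where "M_xx x t = deriv V x * \<tau> t" for x t
  define N_x where "N_x x t = (deriv V x - 43200 * g1 * (w x)\<^sup>2 * \<mu> x) * \<tau> t" for x t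

  have "has_partial_x u u_x"
    unfolding u_x_def
    by (rule has_partial_x_separated [OF u]) (auto intro!: derivative_eq_intros derivs)
  moreover have "has_partial_x u_x u_xx"
    unfolding u_xx_def
    by (rule has_partial_x_separated [OF u_x_def])
      (auto intro!: derivative_eq_intros derivs simp: algebra_simps power2_eq_square)
  moreover have "has_partial_x u_xx u_xxx"
    unfolding u_xxx_def
    by (rule has_partial_x_separated [OF u_xx_def])
      (auto intro!: derivative_eq_intros derivs simp: algebra_simps)
  moreover have "has_partial_t u u_t"
    unfolding u_t_def by (rule has_partial_t_separated [OF u tau])
  moreover have "has_partial_t u_t u_tt"
    unfolding u_tt_def by (rule has_partial_t_separated [OF u_t_def tau'])
  moreover have "has_partial_x (\<lambda>x t. EI x * u_xx x t) M_x"
    unfolding M_x_def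
  proof (rule has_partial_x_separated)
    show "EI x * u_xx x t = bending_moment g1 m0 m1 m2 x * \<tau> t" if "x \<in> {0..1}" for x t
      using assms(6) that by (simp add: bending_moment_def u_xx_def w_def \<mu>_def d_def)
    show "(bending_moment g1 m0 m1 m2 has_real_derivative V x) (at x)" for x
      unfolding V_def using \<mu> by (intro has_derivative_bending_moment) (simp add: \<mu>_def)
  qed
  moreover have "has_partial_x M_x M_xx"
    unfolding M_xx_def by (rule has_partial_x_separated [OF M_x_def dV])
  moreover have "has_partial_x (\<lambda>x t. T x * u_x x t) N_x"
    unfolding N_x_def
  proof (rule has_partial_x_separated)
    show "T x * u_x x t = (V x - 14400 * g1 * w x ^ 3) * \<tau> t" if "x \<in> {0..1}" for x t
      using assms(7) that \<mu> [of x] load_times_slope [of m0 m1 m2 x g1]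
      by (simp add: u_x_def w_def \<mu>_def V_def flip: mult.assoc)
    show "((\<lambda>x. V x - 14400 * g1 * w x ^ 3) has_real_derivative
        deriv V x - 43200 * g1 * (w x)\<^sup>2 * \<mu> x) (at x)" for x
      by (auto intro!: derivative_eq_intros derivs)
  qed
  moreover have "\<forall>x\<in>{0..1}. \<forall>t. M_xx x t + m x * u_tt x t - N_x x t = 0"
    using assms(5) by (simp add: M_xx_def u_tt_def N_x_def freq \<mu>_def algebra_simps)
  moreover have "u 0 t = 0 \<and> u_x 0 t = 0 \<and> u_xx 1 t = 0 \<and> u_xxx 1 t = 0" for t
  proof -
    have "w 0 = 0"
      by (simp add: w_def mass_upto_def)
    then show ?thesis
      using free_end_conditions [OF p(2), of m0, folded coeffs] u [of 0 t]
      by (simp add: u_x_def u_xx_def u_xxx_def w_def \<mu>_def d_def)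
  qed
  ultimately show ?thesis
    by blast
qed

end
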